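(* Let $\nu>0$. Then $$\mathcal{F}^{2,\nu}(\mathbb{T})=\mathcal{F}^{2,\frac{\nu}{2}}(\mathbb{C})\,e_+ +\mathcal{F}^{2,\frac{\nu}{2}}(\mathbb{C})\,e_-,$$ that is, $\mathcal{F}^{2,\nu}(\mathbb{T})$ is exactly the set of functions $f:\mathbb{T}\to\mathbb{T}$ which can be expressed as $$f(\alpha e_+ +\beta e_-)= \phi^{+}(\alpha)\,e_+ + \phi^{-}(\beta)\,e_-\qquad(\alpha,\beta\in\mathbb{C})$$ with $\mathbb{C}$-valued functions $\phi^{\pm}$ belonging to the classical Bargmann space $\mathcal{F}^{2,\frac{\nu}{2}}(\mathbb{C})$. Moreover, for such $f$, $$\|f\|_{\mathcal{H}^{2,\nu}(\mathbb{T})}^2 =\frac{1}{2}\left( \|\phi^+\|^{2}_{L^{2,\frac{\nu}{2}}(\mathbb{C})} + \|\phi^-\|^{2}_{L^{2,\frac{\nu}{2}}(\mathbb{C})} \right).$$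
   Context: Bicomplex numbers: $\mathbb{T}=\{Z=z_1+jz_2:\ z_1,z_2\in\mathbb{C}\}$ is the commutative algebra in which $i^2=j^2=-1$, $ij=ji$ and $\mathbb{C}=\mathbb{R}+i\mathbb{R}$. Put $e_\pm=\frac{1\pm ij}{2}$; then $e_\pm^2=e_\pm$, $e_+e_-=0$, $e_++e_-=1$. Every $Z=z_1+jz_2$ is uniquely $Z=\alpha e_++\beta e_-$ with $\alpha=z_1-iz_2$, $\beta=z_1+iz_2\in\mathbb{C}$; algebraic operations are componentwise in $(\alpha,\beta)$. Set $Z^*=\overline{\alpha}e_++\overline{\beta}e_-$ and $|Z|^2=|z_1|^2+|z_2|^2=\frac{|\alpha|^2+|\beta|^2}{2}$. $\lambda$ is Lebesgue measure on $\mathbb{T}\equiv\mathbb{R}^4$ (real coordinates of $z_1,z_2$). $\mathcal{H}^{2,\nu}(\mathbb{T})$ is the space of Borel measurable $f:\mathbb{T}\to\mathbb{T}$ (modulo a.e. equality) with $\|f\|_{\mathcal{H}^{2,\nu}(\mathbb{T})}<\infty$, where $\langle f,g\rangle=\left(\frac{\nu}{\pi}\right)^2\int_{\mathbb{T}} f(Z)g(Z)^*e^{-\nu|Z|^2}d\lambda(Z)$ and, writing $\langle f,f\rangle=a\,e_++b\,e_-$ with $a,b\ge 0$, $\|f\|^2_{\mathcal{H}^{2,\nu}(\mathbb{T})}=\frac{a+b}{2}$. A function $f:\mathbb{T}\to\mathbb{T}$ is bicomplex holomorphic if for every $Z_0\in\mathbb{T}$ the limit of $\frac{f(Z_0+H)-f(Z_0)}{H}$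 as $H\to0$, $H\notin\mathcal{NC}$, exists and is finite, where $\mathcal{NC}=\{\alpha e_++\beta e_-:\alpha\beta=0\}$. The bicomplex Bargmann space $\mathcal{F}^{2,\nu}(\mathbb{T})$ is the set of bicomplex holomorphic functions on $\mathbb{T}$ belonging to $\mathcal{H}^{2,\nu}(\mathbb{T})$. For $\gamma>0$, $\|\phi\|^2_{L^{2,\gamma}(\mathbb{C})}=\frac{\gamma}{\pi}\int_{\mathbb{C}}|\phi(\xi)|^2e^{-\gamma|\xi|^2}d\lambda(\xi)$, and the classical Bargmann space $\mathcal{F}^{2,\gamma}(\mathbb{C})$ is the space of entire functions $\phi:\mathbb{C}\to\mathbb{C}$ with $\|\phi\|_{L^{2,\gamma}(\mathbb{C})}<\infty$. *)

theory Defs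
  imports "HOL-Analysis.Analysis"
begin

text \<open>
  The bicomplex number \<open>z1 + j z2\<close> is the pair \<open>(z1, z2)\<close>. Addition, topology, Euclidean norm
  \<open>sqrt (\<bar>z1\<bar>^2 + \<bar>z2\<bar>^2)\<close> and Lebesgue measure (on the four real coordinates of \<open>z1, z2\<close>) are those of
  the library's product space \<open>complex \<times> complex\<close>, which carries no multiplication of its own.
\<close>

type_synonym bicomplex = "complex \<times> complex"

definition bc_of_complex :: "complex \<Rightarrow> bicomplex"
  where "bc_of_complex z = (z, 0)"

definition bc_j :: bicomplex
  where "bc_j = (0, 1)"

definition bc_times :: "bicomplex \<Rightarrow> bicomplex \<Rightarrow> bicomplex"  (infixl "*\<^sub>T" 70)
  where "Z *\<^sub>T W = (fst Z * fst W - snd Z * snd W, fst Z * snd W + snd Z * fst W)"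

definition e_plus :: bicomplex
  where "e_plus = (1 / 2) *\<^sub>R (bc_of_complex 1 + bc_of_complex \<i> *\<^sub>T bc_j)"

definition e_minus :: bicomplex
  where "e_minus = (1 / 2) *\<^sub>R (bc_of_complex 1 - bc_of_complex \<i> *\<^sub>T bc_j)"

definition idem :: "complex \<Rightarrow> complex \<Rightarrow> bicomplex"
  where "idem \<alpha> \<beta> = bc_of_complex \<alpha> *\<^sub>T e_plus + bc_of_complex \<beta> *\<^sub>T e_minus"

definition bc_alpha :: "bicomplex \<Rightarrow> complex"
  where "bc_alpha Z = fst Z - \<i> * snd Z"

definition bc_beta :: "bicomplex \<Rightarrow> complex"
  where "bc_beta Z = fst Z + \<i> * snd Z"

definition bc_star :: "bicomplex \<Rightarrow> bicomplex"
  where "bc_star Z = idem (cnj (bc_alpha Z)) (cnj (bc_beta Z))"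

definition null_cone :: "bicomplex set"
  where "null_cone = {Z. bc_alpha Z * bc_beta Z = 0}"

text \<open>The multiplicative inverse of \<open>Z\<close> when \<open>Z \<notin> null_cone\<close>; a junk value otherwise.\<close>

definition bc_inverse :: "bicomplex \<Rightarrow> bicomplex"
  where "bc_inverse Z = idem (inverse (bc_alpha Z)) (inverse (bc_beta Z))"

lemma bc_times_commute: "Z *\<^sub>T W = W *\<^sub>T Z"
  by (simp add: bc_times_def algebra_simps)

lemma bc_times_assoc: "(Z *\<^sub>T W) *\<^sub>T V = Z *\<^sub>T (W *\<^sub>T V)"
  by (simp add: bc_times_def algebra_simps)

lemma bc_times_distrib_left: "Z *\<^sub>T (W + V) = Z *\<^sub>T W + Z *\<^sub>T V"
  by (simp add: bc_times_def algebra_simps)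

lemma bc_times_one: "bc_of_complex 1 *\<^sub>T Z = Z"
  by (simp add: bc_times_def bc_of_complex_def)

lemma bc_j_squared: "bc_j *\<^sub>T bc_j = - bc_of_complex 1"
  by (simp add: bc_times_def bc_of_complex_def bc_j_def)

lemma bc_eq_z1_j_z2: "Z = bc_of_complex (fst Z) + bc_j *\<^sub>T bc_of_complex (snd Z)"
  by (simp add: bc_times_def bc_of_complex_def bc_j_def)

lemma idem_eq: "idem \<alpha> \<beta> = ((\<alpha> + \<beta>) / 2, \<i> * (\<alpha> - \<beta>) / 2)"
  by (simp add: idem_def e_plus_def e_minus_def bc_times_def bc_of_complex_def bc_j_def
      scaleR_conv_of_real field_simps)

lemma bc_alpha_idem [simp]: "bc_alpha (idem \<alpha> \<beta>) = \<alpha>"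
  and bc_beta_idem [simp]: "bc_beta (idem \<alpha> \<beta>) = \<beta>"
  by (simp_all add: idem_eq bc_alpha_def bc_beta_def field_simps)

lemma idem_alpha_beta [simp]: "idem (bc_alpha Z) (bc_beta Z) = Z"
  by (cases Z) (simp add: idem_eq bc_alpha_def bc_beta_def field_simps)

lemma idem_times: "idem \<alpha> \<beta> *\<^sub>T idem \<alpha>' \<beta>' = idem (\<alpha> * \<alpha>') (\<beta> * \<beta>')"
  by (simp add: idem_eq bc_times_def field_simps)

lemma norm_bicomplex_squared:
  "(norm Z)\<^sup>2 = ((cmod (bc_alpha Z))\<^sup>2 + (cmod (bc_beta Z))\<^sup>2) / 2" for Z :: bicomplex
proof (cases Z)
  case (Pair a b)
  have "(norm Z)\<^sup>2 = (cmod a)\<^sup>2 + (cmod b)\<^sup>2"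
    by (simp add: Pair norm_Pair)
  then show ?thesis
    unfolding cmod_power2
    by (simp add: Pair bc_alpha_def bc_beta_def) (simp add: power2_eq_square algebra_simps)
qed

lemma bc_times_inverse:
  assumes "Z \<notin> null_cone"
  shows "Z *\<^sub>T bc_inverse Z = bc_of_complex 1"
proof -
  have "Z *\<^sub>T bc_inverse Z = idem (bc_alpha Z) (bc_beta Z) *\<^sub>T bc_inverse Z" by simp
  also have "\<dots> = idem 1 1"
    using assms by (simp only: bc_inverse_def idem_times) (simp add: null_cone_def)
  finally show ?thesis by (simp add: idem_eq bc_of_complex_def)
qed

definition bc_holomorphic :: "(bicomplex \<Rightarrow> bicomplex) \<Rightarrow> bool"
  where "bc_holomorphic f \<longleftrightarrow>
    (\<forall>Z\<^sub>0. \<exists>D. ((\<lambda>H. (f (Z\<^sub>0 + H) - f Z\<^sub>0) *\<^sub>T bc_inverse H) \<longlongrightarrow> D) (at 0 within - null_cone))"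

definition bc_integrand ::
    "real \<Rightarrow> (bicomplex \<Rightarrow> bicomplex) \<Rightarrow> (bicomplex \<Rightarrow> bicomplex) \<Rightarrow> bicomplex \<Rightarrow> bicomplex"
  where "bc_integrand \<nu> f g Z = exp (- \<nu> * (norm Z)\<^sup>2) *\<^sub>R (f Z *\<^sub>T bc_star (g Z))"

definition bc_inner :: "real \<Rightarrow> (bicomplex \<Rightarrow> bicomplex) \<Rightarrow> (bicomplex \<Rightarrow> bicomplex) \<Rightarrow> bicomplex"
  where "bc_inner \<nu> f g = (\<nu> / pi)\<^sup>2 *\<^sub>R (\<integral>Z. bc_integrand \<nu> f g Z \<partial>lborel)"

lemma bc_integrand_self:
  "bc_integrand \<nu> f f Z =
    idem (of_real (exp (- \<nu> * (norm Z)\<^sup>2) * (cmod (bc_alpha (f Z)))\<^sup>2))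
         (of_real (exp (- \<nu> * (norm Z)\<^sup>2) * (cmod (bc_beta (f Z)))\<^sup>2))"
proof -
  have scale: "c *\<^sub>R idem a b = idem (of_real c * a) (of_real c * b)" for c a b
    by (simp add: idem_eq scaleR_conv_of_real algebra_simps)
  have "f Z *\<^sub>T bc_star (f Z) =
      idem (bc_alpha (f Z)) (bc_beta (f Z)) *\<^sub>T
      idem (cnj (bc_alpha (f Z))) (cnj (bc_beta (f Z)))"
    by (simp add: bc_star_def)
  then show ?thesis
    by (simp only: bc_integrand_def idem_times scale of_real_mult complex_norm_square)
qed

text \<open>
  The idempotent components of \<open>\<langle>f, f\<rangle>\<close> are real and nonnegative, so \<open>Re\<close> only changes the type
  (see \<open>bc_integrand_self\<close>).
\<close>

definition bc_norm :: "real \<Rightarrow> (bicomplex \<Rightarrow> bicomplex) \<Rightarrow> real"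
  where "bc_norm \<nu> f =
    sqrt ((Re (bc_alpha (bc_inner \<nu> f f)) + Re (bc_beta (bc_inner \<nu> f f))) / 2)"

text \<open>
  Since \<open>bc_norm\<close> is real-valued (and the integral of a non-integrable function is \<open>0\<close>), finiteness
  of the norm is expressed by integrability of the integrand of \<open>\<langle>f, f\<rangle>\<close>. Elements are functions,
  not classes modulo almost everywhere equality.
\<close>

definition H2_space :: "real \<Rightarrow> (bicomplex \<Rightarrow> bicomplex) set"
  where "H2_space \<nu> = {f. f \<in> borel_measurable borel \<and> integrable lborel (bc_integrand \<nu> f f)}"

definition bc_bargmann :: "real \<Rightarrow> (bicomplex \<Rightarrow> bicomplex) set"
  where "bc_bargmann \<nu> = {f. bc_holomorphic f \<and> f \<in> H2_space \<nu>}"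

definition gauss_integrand :: "real \<Rightarrow> (complex \<Rightarrow> complex) \<Rightarrow> complex \<Rightarrow> real"
  where "gauss_integrand \<gamma> \<phi> \<xi> = (cmod (\<phi> \<xi>))\<^sup>2 * exp (- \<gamma> * (cmod \<xi>)\<^sup>2)"

definition L2_norm :: "real \<Rightarrow> (complex \<Rightarrow> complex) \<Rightarrow> real"
  where "L2_norm \<gamma> \<phi> = sqrt (\<gamma> / pi * (\<integral>\<xi>. gauss_integrand \<gamma> \<phi> \<xi> \<partial>lborel))"

definition bargmann :: "real \<Rightarrow> (complex \<Rightarrow> complex) set"
  where "bargmann \<gamma> = {\<phi>. \<phi> holomorphic_on UNIV \<and> integrable lborel (gauss_integrand \<gamma> \<phi>)}"

end

theory Submission
  imports Defs "HOL-Probability.Distributions"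
begin

text \<open>
  In the idempotent coordinates \<open>(\<alpha>, \<beta>)\<close> both defining conditions of the bicomplex Bargmann space
  decouple.

  Holomorphy: division by \<open>H = h e\<^sub>+ + k e\<^sub>-\<close> divides the \<open>e\<^sub>+\<close>-component of an increment by \<open>h\<close> and
  its \<open>e\<^sub>-\<close>-component by \<open>k\<close>. Boundedness of these quotients forces the \<open>e\<^sub>+\<close>-component to be
  independent of \<open>\<beta>\<close> and the \<open>e\<^sub>-\<close>-component to be independent of \<open>\<alpha>\<close>
  (\<open>quotient_limit_imp_independent\<close>); what remains of the limit is ordinary complex
  differentiability. So bicomplex holomorphic functions are exactly the functions
  \<open>\<phi>\<^sup>+(\<alpha>) e\<^sub>+ + \<phi>\<^sup>-(\<beta>) e\<^sub>-\<close> with \<open>\<phi>\<^sup>\<plusminus>\<close> entire (\<open>bc_holomorphic_imp_split\<close>, \<open>split_imp_bc_holomorphic\<close>).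

  Integrability: up to the factor \<open>\<surd>2\<close>, the change of coordinates is an isometry of \<open>\<real>\<^sup>4\<close>, so
  \<open>d\<lambda>(Z) = d\<lambda>(\<alpha>) d\<lambda>(\<beta>) / 4\<close>, and the weight is the product
  \<open>exp (-\<nu>|\<alpha>|\<^sup>2/2) exp (-\<nu>|\<beta>|\<^sup>2/2)\<close>. By Fubini, the integral of a function of \<open>\<alpha>\<close> alone against the
  weight is its planar Gaussian integral times \<open>(1/4) (\<pi>/(\<nu>/2)) = \<pi>/(2\<nu>)\<close>
  (\<open>gauss_integral_alpha\<close>, \<open>gauss_integral_beta\<close>). As \<open>(\<nu>/\<pi>)\<^sup>2 \<pi>/(2\<nu>) = (\<nu>/2)/\<pi>\<close>, the components
  of \<open>\<langle>f, f\<rangle>\<close> are the squared classical norms of \<open>\<phi>\<^sup>\<plusminus>\<close>.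
\<close>

section \<open>Idempotent coordinates\<close>

lemma bounded_linear_bc_alpha: "bounded_linear bc_alpha"
  unfolding bc_alpha_def
  by (intro bounded_linear_sub bounded_linear_fst bounded_linear_snd
      bounded_linear_const_mult)

lemma bounded_linear_bc_beta: "bounded_linear bc_beta"
  unfolding bc_beta_def
  by (intro bounded_linear_add bounded_linear_fst bounded_linear_snd
      bounded_linear_const_mult)

lemmas bc_alpha_linear [simp] =
  bounded_linear.linear[OF bounded_linear_bc_alpha, THEN linear_add]
  bounded_linear.linear[OF bounded_linear_bc_alpha, THEN linear_diff]
  bounded_linear.linear[OF bounded_linear_bc_alpha, THEN linear_0]

lemmas bc_beta_linear [simp] =
  bounded_linear.linear[OF bounded_linear_bc_beta, THEN linear_add]
  bounded_linear.linear[OF bounded_linear_bc_beta, THEN linear_diff]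
  bounded_linear.linear[OF bounded_linear_bc_beta, THEN linear_0]

lemma borel_measurable_bc_components [measurable]:
  "bc_alpha \<in> borel_measurable borel" "bc_beta \<in> borel_measurable borel"
  by (intro borel_measurable_continuous_onI linear_continuous_on
      bounded_linear_bc_alpha bounded_linear_bc_beta)+

lemma bc_alpha_times [simp]: "bc_alpha (Z *\<^sub>T W) = bc_alpha Z * bc_alpha W"
  and bc_beta_times [simp]: "bc_beta (Z *\<^sub>T W) = bc_beta Z * bc_beta W"
  by (metis idem_alpha_beta idem_times bc_alpha_idem, metis idem_alpha_beta idem_times bc_beta_idem)

lemma bc_alpha_inverse [simp]: "bc_alpha (bc_inverse Z) = inverse (bc_alpha Z)"
  and bc_beta_inverse [simp]: "bc_beta (bc_inverse Z) = inverse (bc_beta Z)"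
  by (simp_all add: bc_inverse_def)

lemma bicomplex_eq_iff: "Z = W \<longleftrightarrow> bc_alpha Z = bc_alpha W \<and> bc_beta Z = bc_beta W"
  by (metis idem_alpha_beta)

lemma idem_add: "idem a b + idem h k = idem (a + h) (b + k)"
  by (simp add: bicomplex_eq_iff)

lemma tendsto_idem:
  assumes "(u \<longlongrightarrow> a) F" "(v \<longlongrightarrow> b) F"
  shows "((\<lambda>x. idem (u x) (v x)) \<longlongrightarrow> idem a b) F"
  unfolding idem_eq using assms by (intro tendsto_intros) auto

lemma tendsto_bicomplex_iff:
  "(u \<longlongrightarrow> D) F \<longleftrightarrow>
    ((\<lambda>x. bc_alpha (u x)) \<longlongrightarrow> bc_alpha D) F \<and> ((\<lambda>x. bc_beta (u x)) \<longlongrightarrow> bc_beta D) F"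
  using tendsto_idem[of "\<lambda>x. bc_alpha (u x)" "bc_alpha D" F "\<lambda>x. bc_beta (u x)" "bc_beta D"]
  by (auto intro: bounded_linear.tendsto[OF bounded_linear_bc_alpha]
      bounded_linear.tendsto[OF bounded_linear_bc_beta])

section \<open>Bicomplex holomorphic functions split\<close>

text \<open>
  A neighbourhood of \<open>0\<close> off the null cone contains all \<open>h e\<^sub>+ + k e\<^sub>-\<close> with \<open>h, k \<noteq> 0\<close> small, because
  \<open>|h e\<^sub>+ + k e\<^sub>-|\<^sup>2 = (|h|\<^sup>2 + |k|\<^sup>2)/2\<close>.
\<close>

lemma eventually_off_null_cone:
  assumes "eventually P (at 0 within - null_cone)"
  obtains d where "d > 0"
    and "\<And>h k. \<lbrakk>h \<noteq> 0; k \<noteq> 0; cmod h < d; cmod k < d\<rbrakk> \<Longrightarrow> P (idem h k)"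
proof -
  from assms obtain d where d: "d > 0"
    "\<And>H. \<lbrakk>H \<in> - null_cone; H \<noteq> 0; dist H 0 < d\<rbrakk> \<Longrightarrow> P H"
    unfolding eventually_at by blast
  have "P (idem h k)" if hk: "h \<noteq> 0" "k \<noteq> 0" "cmod h < d" "cmod k < d" for h k
  proof (rule d(2))
    show "idem h k \<in> - null_cone" using hk by (simp add: null_cone_def)
    show "idem h k \<noteq> 0" using hk by (simp add: bicomplex_eq_iff)
    have "(cmod h)\<^sup>2 < d\<^sup>2" "(cmod k)\<^sup>2 < d\<^sup>2"
      using hk by (simp_all add: power_strict_mono)
    then have "(norm (idem h k))\<^sup>2 < d\<^sup>2"
      by (simp add: norm_bicomplex_squared)
    then show "dist (idem h k) 0 < d"
      using d(1) by (simp add: power_less_imp_less_base)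
  qed
  with d(1) show ?thesis by (rule that)
qed

text \<open>
  The hypothesis says nothing about increments along the null cone, so \<open>u a b\<close> and \<open>u a b'\<close> cannot be
  compared directly. For \<open>b'\<close> near \<open>b\<close>, however, both are limits as \<open>h \<rightarrow> 0\<close> of the same values
  \<open>u (a + h) c\<close>, where \<open>c\<close> is close to and different from both \<open>b\<close> and \<open>b'\<close>. Hence \<open>u a\<close> is locally
  constant, and \<open>\<complex>\<close> is connected.
\<close>

lemma quotient_bounded_imp_independent:
  fixes u :: "complex \<Rightarrow> complex \<Rightarrow> complex"
  assumes bound: "\<And>a b. \<exists>d>0. \<exists>C. \<forall>h k. h \<noteq> 0 \<longrightarrow> k \<noteq> 0 \<longrightarrow> cmod h < d \<longrightarrow> cmod k < d \<longrightarrow>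
    cmod (u (a + h) (b + k) - u a b) \<le> C * cmod h"
  shows "u a b = u a b'"
proof (rule connected_local_const[of UNIV b b' "u a"])
  have "eventually (\<lambda>b'. u a b = u a b') (at b)" for b
  proof -
    obtain d C where d: "d > 0" and C: "\<And>h k. \<lbrakk>h \<noteq> 0; k \<noteq> 0; cmod h < d; cmod k < d\<rbrakk> \<Longrightarrow>
        cmod (u (a + h) (b + k) - u a b) \<le> C * cmod h"
      using bound[of a b] by blast
    have "u a b = u a b'" if b': "b' \<noteq> b" "dist b' b < d" for b'
    proof -
      obtain d' C' where d': "d' > 0"
        and C': "\<And>h k. \<lbrakk>h \<noteq> 0; k \<noteq> 0; cmod h < d'; cmod k < d'\<rbrakk> \<Longrightarrow>
          cmod (u (a + h) (b' + k) - u a b') \<le> C' * cmod h"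
        using bound[of a b'] by blast
      define r where "r = min (min (dist b' b) (d - dist b' b)) d' / 2"
      have r: "r > 0" "r < dist b' b" "r < d - dist b' b" "r < d'"
        using b' d' by (auto simp: r_def min_def field_simps)
      define c where "c = b' + of_real r"
      have c: "cmod (c - b') = r" "c - b' \<noteq> 0" using r by (auto simp: c_def)
      have "dist c b' = r" using c by (simp add: dist_norm)
      then have "dist c b < d" "c \<noteq> b"
        using r dist_triangle[of c b b'] by (auto simp: dist_commute)
      then have cb: "cmod (c - b) < d" "c - b \<noteq> 0" by (auto simp: dist_norm)
      have "eventually (\<lambda>h. cmod h < min d d') (at 0)"
        using d d' by (intro order_tendstoD(2)[OF tendsto_norm_zero[OF tendsto_ident_at]]) auto
      moreover have "eventually (\<lambda>h::complex. h \<noteq> 0) (at 0)"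
        by (simp add: eventually_at_filter)
      ultimately have "eventually (\<lambda>h. cmod (u a b - u a b') \<le> (C + C') * cmod h) (at 0)"
      proof eventually_elim
        case (elim h)
        have "cmod (u (a + h) c - u a b) \<le> C * cmod h"
          using C[of h "c - b"] elim cb by simp
        moreover have "cmod (u (a + h) c - u a b') \<le> C' * cmod h"
          using C'[of h "c - b'"] elim c r by simp
        moreover have "cmod (u a b - u a b') \<le> cmod (u (a + h) c - u a b') + cmod (u (a + h) c - u a b)"
          using norm_triangle_ineq4[of "u (a + h) c - u a b'" "u (a + h) c - u a b"] by simp
        ultimately have "cmod (u a b - u a b') \<le> C' * cmod h + C * cmod h"
          by linarith
        then show ?case by (simp add: algebra_simps)
      qed
      moreover have "((\<lambda>h. (C + C') * cmod h) \<longlongrightarrow> (C + C') * cmod 0) (at 0)"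
        by (intro tendsto_intros)
      ultimately have "cmod (u a b - u a b') \<le> (C + C') * cmod 0"
        by (intro tendsto_lowerbound[of _ _ "at 0"]) auto
      then show ?thesis by simp
    qed
    then show ?thesis unfolding eventually_at using d by blast
  qed
  then show "\<forall>b\<in>UNIV. eventually (\<lambda>b'. u a b = u a b') (at b within UNIV)" by simp
qed auto

text \<open>
  A convergent quotient is bounded near \<open>0\<close>, which gives independence of the second argument. The
  limit is then that of an ordinary difference quotient in the first argument.
\<close>

lemma quotient_limit_imp_independent:
  fixes u :: "complex \<Rightarrow> complex \<Rightarrow> complex"
  assumes lim: "\<And>a b. \<exists>D. \<forall>e>0. \<exists>d>0. \<forall>h k. h \<noteq> 0 \<longrightarrow> k \<noteq> 0 \<longrightarrow> cmod h < d \<longrightarrow> cmod k < d \<longrightarrow>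
    dist ((u (a + h) (b + k) - u a b) * inverse h) D < e"
  shows "u a b = u a b'" and "(\<lambda>a. u a c) holomorphic_on UNIV"
proof -
  have bound: "\<exists>d>0. \<exists>C. \<forall>h k. h \<noteq> 0 \<longrightarrow> k \<noteq> 0 \<longrightarrow> cmod h < d \<longrightarrow> cmod k < d \<longrightarrow>
    cmod (u (a + h) (b + k) - u a b) \<le> C * cmod h" for a b
  proof -
    obtain D where "\<forall>e>0. \<exists>d>0. \<forall>h k. h \<noteq> 0 \<longrightarrow> k \<noteq> 0 \<longrightarrow> cmod h < d \<longrightarrow> cmod k < d \<longrightarrow>
        dist ((u (a + h) (b + k) - u a b) * inverse h) D < e"
      using lim[of a b] by (rule exE)
    from this[rule_format, OF zero_less_one] obtain d where d: "d > 0"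
      and D: "\<And>h k. \<lbrakk>h \<noteq> 0; k \<noteq> 0; cmod h < d; cmod k < d\<rbrakk> \<Longrightarrow>
        dist ((u (a + h) (b + k) - u a b) * inverse h) D < 1"
      by auto
    have "cmod (u (a + h) (b + k) - u a b) \<le> (cmod D + 1) * cmod h"
      if hk: "h \<noteq> 0" "k \<noteq> 0" "cmod h < d" "cmod k < d" for h k
    proof -
      let ?q = "(u (a + h) (b + k) - u a b) * inverse h"
      have "cmod ?q \<le> cmod D + 1"
        using D[OF hk] norm_triangle_ineq2[of ?q D] by (simp add: dist_norm)
      then have "cmod ?q * cmod h \<le> (cmod D + 1) * cmod h"
        by (intro mult_right_mono) auto
      moreover have "?q * h = u (a + h) (b + k) - u a b" using hk by simp
      ultimately show ?thesis by (metis norm_mult)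
    qed
    with d show ?thesis by blast
  qed
  show indep: "u a b = u a b'" for a b b'
    by (rule quotient_bounded_imp_independent[OF bound])
  have "(\<lambda>a. u a c) field_differentiable at a" for a
  proof -
    obtain D where D: "\<And>e. e > 0 \<Longrightarrow> \<exists>d>0. \<forall>h k. h \<noteq> 0 \<longrightarrow> k \<noteq> 0 \<longrightarrow> cmod h < d \<longrightarrow> cmod k < d \<longrightarrow>
      dist ((u (a + h) (c + k) - u a c) * inverse h) D < e"
      using lim[of a c] by blast
    have "((\<lambda>h. (u (a + h) c - u a c) / h) \<longlongrightarrow> D) (at 0)"
      unfolding tendsto_iff eventually_at
    proof (intro allI impI)
      fix e :: real assume "e > 0"
      from D[OF this] obtain d where d: "d > 0"
        "\<And>h k. \<lbrakk>h \<noteq> 0; k \<noteq> 0; cmod h < d; cmod k < d\<rbrakk> \<Longrightarrow>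
          dist ((u (a + h) (c + k) - u a c) * inverse h) D < e"
        by auto
      \<comment> \<open>by independence, any admissible second increment will do\<close>
      define k :: complex where "k = of_real (d / 2)"
      have k: "k \<noteq> 0" "cmod k < d" using d(1) by (simp_all add: k_def)
      have "dist ((u (a + h) c - u a c) / h) D < e" if h: "h \<noteq> 0" "dist h 0 < d" for h
      proof -
        have "cmod h < d" using h(2) by simp
        from d(2)[OF h(1) k(1) this k(2)] show ?thesis
          by (simp only: divide_inverse indep[of "a + h" "c + k" c])
      qed
      with d(1) show "\<exists>d>0. \<forall>h\<in>UNIV. h \<noteq> 0 \<and> dist h 0 < d \<longrightarrow>
          dist ((u (a + h) c - u a c) / h) D < e" by auto
    qed
    then show ?thesis
      unfolding field_differentiable_def DERIV_def by blast
  qed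
  then show "(\<lambda>a. u a c) holomorphic_on UNIV"
    by (simp add: holomorphic_on_def field_differentiable_at_within)
qed

text \<open>
  Each idempotent component of \<open>f\<close>, with its own variable put first, satisfies the hypothesis of
  \<open>quotient_limit_imp_independent\<close>, since division by \<open>H\<close> acts componentwise.
\<close>

lemma bc_holomorphic_imp_split:
  assumes "bc_holomorphic f"
  obtains \<phi> \<psi> where "\<phi> holomorphic_on UNIV" "\<psi> holomorphic_on UNIV"
    "\<And>a b. f (idem a b) = idem (\<phi> a) (\<psi> b)"
proof -
  define u where "u a b = bc_alpha (f (idem a b))" for a b
  \<comment> \<open>arguments swapped, so that the quotient divides by the increment of the first one\<close>
  define v where "v b a = bc_beta (f (idem a b))" for a b
  have lim: "(\<exists>D. \<forall>e>0. \<exists>d>0. \<forall>h k. h \<noteq> 0 \<longrightarrow> k \<noteq> 0 \<longrightarrow> cmod h < d \<longrightarrow> cmod k < d \<longrightarrow>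
      dist ((u (a + h) (b + k) - u a b) * inverse h) D < e) \<and>
    (\<exists>D. \<forall>e>0. \<exists>d>0. \<forall>k h. k \<noteq> 0 \<longrightarrow> h \<noteq> 0 \<longrightarrow> cmod k < d \<longrightarrow> cmod h < d \<longrightarrow>
      dist ((v (b + k) (a + h) - v b a) * inverse k) D < e)" for a b
  proof -
    obtain D where "((\<lambda>H. (f (idem a b + H) - f (idem a b)) *\<^sub>T bc_inverse H) \<longlongrightarrow> D)
        (at 0 within - null_cone)"
      using assms unfolding bc_holomorphic_def by blast
    then have
      A: "((\<lambda>H. (bc_alpha (f (idem a b + H)) - bc_alpha (f (idem a b))) * inverse (bc_alpha H))
        \<longlongrightarrow> bc_alpha D) (at 0 within - null_cone)" and
      B: "((\<lambda>H. (bc_beta (f (idem a b + H)) - bc_beta (f (idem a b))) * inverse (bc_beta H))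
        \<longlongrightarrow> bc_beta D) (at 0 within - null_cone)"
      by (simp_all add: tendsto_bicomplex_iff)
    have "\<exists>d>0. \<forall>h k. h \<noteq> 0 \<longrightarrow> k \<noteq> 0 \<longrightarrow> cmod h < d \<longrightarrow> cmod k < d \<longrightarrow>
      dist ((u (a + h) (b + k) - u a b) * inverse h) (bc_alpha D) < e" if e: "e > 0" for e
      by (rule eventually_off_null_cone[OF tendstoD[OF A e]]) (auto simp: u_def idem_add)
    moreover have "\<exists>d>0. \<forall>k h. k \<noteq> 0 \<longrightarrow> h \<noteq> 0 \<longrightarrow> cmod k < d \<longrightarrow> cmod h < d \<longrightarrow>
      dist ((v (b + k) (a + h) - v b a) * inverse k) (bc_beta D) < e" if e: "e > 0" for e
      by (rule eventually_off_null_cone[OF tendstoD[OF B e]]) (auto simp: v_def idem_add)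
    ultimately show ?thesis by blast
  qed
  note u = quotient_limit_imp_independent[of u, OF conjunct1[OF lim]]
  note v = quotient_limit_imp_independent[of v, OF conjunct2[OF lim]]
  have "f (idem a b) = idem (u a 0) (v b 0)" for a b
    using u(1)[of a b 0] v(1)[of b a 0] by (simp add: bicomplex_eq_iff u_def v_def)
  with u(2) v(2) show ?thesis by (rule that)
qed

text \<open>
  Off the null cone both components of \<open>H\<close> are nonzero. Hence classical difference quotients may be
  composed with either component of a bicomplex increment.
\<close>

lemma filterlim_component_off_null_cone:
  "filterlim bc_alpha (at 0) (at 0 within - null_cone)"
  "filterlim bc_beta (at 0) (at 0 within - null_cone)"
proof -
  have "(bc_alpha \<longlongrightarrow> 0) (at 0 within - null_cone)" "(bc_beta \<longlongrightarrow> 0) (at 0 within - null_cone)"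
    using bounded_linear.tendsto[OF bounded_linear_bc_alpha tendsto_ident_at[of 0 "- null_cone"]]
      bounded_linear.tendsto[OF bounded_linear_bc_beta tendsto_ident_at[of 0 "- null_cone"]]
    by simp_all
  then show "filterlim bc_alpha (at 0) (at 0 within - null_cone)"
    "filterlim bc_beta (at 0) (at 0 within - null_cone)"
    by (auto simp: filterlim_at eventually_at_filter null_cone_def)
qed

lemma split_imp_bc_holomorphic:
  assumes "\<phi> holomorphic_on UNIV" "\<psi> holomorphic_on UNIV"
    and f: "\<And>a b. f (idem a b) = idem (\<phi> a) (\<psi> b)"
  shows "bc_holomorphic f"
  unfolding bc_holomorphic_def
proof
  fix Z
  have f': "f W = idem (\<phi> (bc_alpha W)) (\<psi> (bc_beta W))" for W
    using f[of "bc_alpha W" "bc_beta W"] by simp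
  have "(\<phi> has_field_derivative deriv \<phi> (bc_alpha Z)) (at (bc_alpha Z))"
    "(\<psi> has_field_derivative deriv \<psi> (bc_beta Z)) (at (bc_beta Z))"
    by (rule holomorphic_derivI[OF assms(1) open_UNIV UNIV_I]
        holomorphic_derivI[OF assms(2) open_UNIV UNIV_I])+
  note deriv = this[unfolded DERIV_def]
  from filterlim_compose[OF deriv(1) filterlim_component_off_null_cone(1)]
    filterlim_compose[OF deriv(2) filterlim_component_off_null_cone(2)]
  have "((\<lambda>H. (f (Z + H) - f Z) *\<^sub>T bc_inverse H) \<longlongrightarrow>
      idem (deriv \<phi> (bc_alpha Z)) (deriv \<psi> (bc_beta Z))) (at 0 within - null_cone)"
    by (simp add: tendsto_bicomplex_iff f' divide_inverse)
  then show "\<exists>D. ((\<lambda>H. (f (Z + H) - f Z) *\<^sub>T bc_inverse H) \<longlongrightarrow> D) (at 0 within - null_cone)"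
    by blast
qed

section \<open>Lebesgue measure in idempotent coordinates\<close>

text \<open>
  Multiplication by \<open>i\<close> permutes the coordinate axes up to sign, so it maps boxes to boxes of the same
  area, and boxes determine Lebesgue measure.
\<close>

lemma lborel_distr_mult_ii: "distr lborel borel ((*) \<i>) = (lborel :: complex measure)"
proof (rule lborel_eqI[symmetric])
  fix l u :: complex
  assume le: "\<And>b. b \<in> Basis \<Longrightarrow> l \<bullet> b \<le> u \<bullet> b"
  let ?l = "Complex (Im l) (- Re u)" and ?u = "Complex (Im u) (- Re l)"
  have le': "Re l \<le> Re u" "Im l \<le> Im u"
    using le[of 1] le[of \<i>] by (auto simp: Basis_complex_def)
  have "(*) \<i> -` box l u = box ?l ?u"
    by (auto simp: box_def Basis_complex_def)
  then have "emeasure (distr lborel borel ((*) \<i>)) (box l u) = emeasure lborel (box ?l ?u)"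
    by (simp add: emeasure_distr)
  also have "\<dots> = (\<Prod>b\<in>Basis. (?u - ?l) \<bullet> b)"
    using le' by (intro emeasure_lborel_box) (auto simp: Basis_complex_def)
  also have "(\<Prod>b\<in>Basis. (?u - ?l) \<bullet> b) = (\<Prod>b\<in>Basis. (u - l) \<bullet> b)"
    by (simp add: Basis_complex_def mult.commute)
  finally show "emeasure (distr lborel borel ((*) \<i>)) (box l u) = (\<Prod>b\<in>Basis. (u - l) \<bullet> b)" .
qed simp

lemma nn_integral_lborel_translate:
  fixes g :: "'a::euclidean_space \<Rightarrow> ennreal"
  assumes [measurable]: "g \<in> borel_measurable borel"
  shows "(\<integral>\<^sup>+z. g z \<partial>lborel) = (\<integral>\<^sup>+z. g (t + z) \<partial>lborel)"
  by (subst lborel_distr_plus[of t, symmetric]) (simp add: nn_integral_distr)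

text \<open>
  Written for the substitution \<open>z\<^sub>2 = i (\<alpha> - \<beta>)/2\<close> with \<open>t = i \<alpha>/2\<close>.
\<close>

lemma nn_integral_complex_half_rotation:
  fixes g :: "complex \<Rightarrow> ennreal"
  assumes [measurable]: "g \<in> borel_measurable borel"
  shows "(\<integral>\<^sup>+z. g z \<partial>lborel) = ennreal (1 / 4) * (\<integral>\<^sup>+z. g (t - \<i> * z / 2) \<partial>lborel)"
proof -
  have "(\<integral>\<^sup>+z. g z \<partial>lborel) = ennreal (1 / 4) * (\<integral>\<^sup>+z. g (t + (- 1 / 2) *\<^sub>R z) \<partial>lborel)"
    by (subst lborel_affine[of "- 1 / 2" t])
       (simp_all add: nn_integral_density nn_integral_distr nn_integral_cmult power2_eq_square)
  also have "(\<integral>\<^sup>+z. g (t + (- 1 / 2) *\<^sub>R z) \<partial>lborel) =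
      (\<integral>\<^sup>+z. g (t + (- 1 / 2) *\<^sub>R z) \<partial>distr lborel borel ((*) \<i>))"
    by (simp only: lborel_distr_mult_ii)
  also have "\<dots> = (\<integral>\<^sup>+z. g (t - \<i> * z / 2) \<partial>lborel)"
    by (simp add: nn_integral_distr scaleR_conv_of_real)
  finally show ?thesis .
qed

text \<open>
  The coordinate change \<open>(z\<^sub>1, z\<^sub>2) \<mapsto> (\<alpha>, \<beta>)\<close> is done one complex variable at a time: first
  \<open>z\<^sub>1 = \<alpha> + i z\<^sub>2\<close> with \<open>z\<^sub>2\<close> fixed, a translation; then \<open>z\<^sub>2 = i (\<alpha> - \<beta>)/2\<close> with \<open>\<alpha>\<close> fixed, a
  translation, a rotation, and a homothety of ratio \<open>1/2\<close>, which produces the factor \<open>1/4\<close>.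
\<close>

lemma nn_integral_idem:
  fixes F :: "bicomplex \<Rightarrow> ennreal"
  assumes "F \<in> borel_measurable borel"
  shows "(\<integral>\<^sup>+Z. F Z \<partial>lborel) =
    ennreal (1 / 4) * (\<integral>\<^sup>+\<alpha>. (\<integral>\<^sup>+\<beta>. F (idem \<alpha> \<beta>) \<partial>lborel) \<partial>lborel)"
proof -
  have [measurable]: "F \<in> borel_measurable (borel \<Otimes>\<^sub>M borel)"
    using assms by (simp add: borel_prod)
  have "(\<integral>\<^sup>+Z. F Z \<partial>lborel) = (\<integral>\<^sup>+w. (\<integral>\<^sup>+z. F (z, w) \<partial>lborel) \<partial>lborel)"
    by (subst lborel_prod[symmetric], subst lborel_pair.nn_integral_snd[symmetric]) auto
  also have "\<dots> = (\<integral>\<^sup>+w. (\<integral>\<^sup>+\<alpha>. F (\<i> * w + \<alpha>, w) \<partial>lborel) \<partial>lborel)"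
    by (intro nn_integral_cong nn_integral_lborel_translate) measurable
  also have "\<dots> = (\<integral>\<^sup>+\<alpha>. (\<integral>\<^sup>+w. F (\<i> * w + \<alpha>, w) \<partial>lborel) \<partial>lborel)"
    by (intro lborel_pair.Fubini') measurable
  also have "\<dots> = (\<integral>\<^sup>+\<alpha>. ennreal (1 / 4) * (\<integral>\<^sup>+\<beta>. F (idem \<alpha> \<beta>) \<partial>lborel) \<partial>lborel)"
  proof (intro nn_integral_cong)
    fix \<alpha> :: complex
    have "(\<i> * (\<i> * \<alpha> / 2 - \<i> * \<beta> / 2) + \<alpha>, \<i> * \<alpha> / 2 - \<i> * \<beta> / 2) = idem \<alpha> \<beta>" for \<beta>
      by (simp add: idem_eq field_simps)
    then show "(\<integral>\<^sup>+w. F (\<i> * w + \<alpha>, w) \<partial>lborel) = ennreal (1 / 4) * (\<integral>\<^sup>+\<beta>. F (idem \<alpha> \<beta>) \<partial>lborel)"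
      by (subst nn_integral_complex_half_rotation[where t = "\<i> * \<alpha> / 2"]) simp_all
  qed
  also have "\<dots> = ennreal (1 / 4) * (\<integral>\<^sup>+\<alpha>. (\<integral>\<^sup>+\<beta>. F (idem \<alpha> \<beta>) \<partial>lborel) \<partial>lborel)"
    unfolding idem_eq by (intro nn_integral_cmult) measurable
  finally show ?thesis .
qed

section \<open>Gaussian integrals\<close>

lemma nn_integral_gauss_real:
  assumes "c > 0"
  shows "(\<integral>\<^sup>+x. ennreal (exp (- c * x\<^sup>2)) \<partial>lborel) = ennreal (sqrt (pi / c))"
proof -
  define s where "s = sqrt (1 / (2 * c))"
  have s: "s > 0" "s\<^sup>2 = 1 / (2 * c)" using assms by (simp_all add: s_def)
  \<comment> \<open>the normal density of variance \<open>1 / (2 c)\<close>, which has total mass \<open>1\<close>\<close>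
  have "exp (- c * x\<^sup>2) = sqrt (pi / c) * normal_density 0 s x" for x
    using assms by (simp add: normal_density_def s(2) real_sqrt_divide mult.commute)
  then have "(\<integral>\<^sup>+x. ennreal (exp (- c * x\<^sup>2)) \<partial>lborel) =
      (\<integral>\<^sup>+x. ennreal (sqrt (pi / c)) * ennreal (normal_density 0 s x) \<partial>lborel)"
    using assms by (simp add: ennreal_mult)
  also have "\<dots> = ennreal (sqrt (pi / c))"
    using s(1) by (simp add: nn_integral_cmult nn_integral_eq_integral)
  finally show ?thesis .
qed

text \<open>
  The weight is a product over the two real coordinates, each contributing \<open>\<surd>(\<pi>/c)\<close>.
\<close>

lemma nn_integral_gauss_complex:
  assumes "c > 0"
  shows "(\<integral>\<^sup>+\<xi>. ennreal (exp (- c * (cmod \<xi>)\<^sup>2)) \<partial>lborel) = ennreal (pi / c)"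
proof -
  have "(\<integral>\<^sup>+\<xi>. ennreal (exp (- c * (cmod \<xi>)\<^sup>2)) \<partial>lborel) =
      (\<integral>\<^sup>+\<xi>. ennreal (\<Prod>b\<in>Basis. exp (- c * (\<xi> \<bullet> (b :: complex))\<^sup>2)) \<partial>lborel)"
    by (simp add: Basis_complex_def cmod_power2 exp_add[symmetric] algebra_simps)
  also have "\<dots> = (\<Prod>b\<in>(Basis :: complex set). (\<integral>\<^sup>+x. ennreal (exp (- c * x\<^sup>2)) \<partial>lborel))"
    using nn_integral_lborel_prod[of "\<lambda>b::complex. \<lambda>x. ennreal (exp (- c * x\<^sup>2))"]
    by (simp add: prod_ennreal)
  also have "\<dots> = ennreal (pi / c)"
    using assms unfolding nn_integral_gauss_real[OF assms]
    by (simp add: Basis_complex_def ennreal_mult[symmetric])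
  finally show ?thesis .
qed

lemma exp_norm_idem:
  "exp (- \<nu> * (norm (idem \<alpha> \<beta>))\<^sup>2) =
    exp (- (\<nu> / 2) * (cmod \<alpha>)\<^sup>2) * exp (- (\<nu> / 2) * (cmod \<beta>)\<^sup>2)"
  by (simp add: norm_bicomplex_squared exp_add[symmetric] algebra_simps add_divide_distrib)

text \<open>
  The weight separates in idempotent coordinates, so Fubini turns the integral of a product of a
  function of \<open>\<alpha>\<close> and a function of \<open>\<beta>\<close> into a product of planar integrals. With one of the two
  functions equal to \<open>1\<close>, its factor is the total Gaussian mass \<open>\<pi>/(\<nu>/2)\<close>.
\<close>

lemma nn_integral_gauss_product:
  fixes A B :: "complex \<Rightarrow> ennreal"
  assumes [measurable]: "A \<in> borel_measurable borel" "B \<in> borel_measurable borel"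
  shows "(\<integral>\<^sup>+Z. ennreal (exp (- \<nu> * (norm Z)\<^sup>2)) * (A (bc_alpha Z) * B (bc_beta Z)) \<partial>lborel) =
    ennreal (1 / 4) * ((\<integral>\<^sup>+\<xi>. A \<xi> * ennreal (exp (- (\<nu> / 2) * (cmod \<xi>)\<^sup>2)) \<partial>lborel) *
      (\<integral>\<^sup>+\<xi>. B \<xi> * ennreal (exp (- (\<nu> / 2) * (cmod \<xi>)\<^sup>2)) \<partial>lborel))"
proof -
  let ?A = "\<lambda>\<xi>. A \<xi> * ennreal (exp (- (\<nu> / 2) * (cmod \<xi>)\<^sup>2))"
  let ?B = "\<lambda>\<xi>. B \<xi> * ennreal (exp (- (\<nu> / 2) * (cmod \<xi>)\<^sup>2))"
  have "(\<integral>\<^sup>+Z. ennreal (exp (- \<nu> * (norm Z)\<^sup>2)) * (A (bc_alpha Z) * B (bc_beta Z)) \<partial>lborel) =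
      ennreal (1 / 4) * (\<integral>\<^sup>+\<alpha>. (\<integral>\<^sup>+\<beta>. ?A \<alpha> * ?B \<beta> \<partial>lborel) \<partial>lborel)"
    by (subst nn_integral_idem, simp, simp only: exp_norm_idem bc_alpha_idem bc_beta_idem)
      (simp add: ennreal_mult mult_ac)
  also have "(\<integral>\<^sup>+\<alpha>. (\<integral>\<^sup>+\<beta>. ?A \<alpha> * ?B \<beta> \<partial>lborel) \<partial>lborel) =
      (\<integral>\<^sup>+\<alpha>. ?A \<alpha> \<partial>lborel) * (\<integral>\<^sup>+\<beta>. ?B \<beta> \<partial>lborel)"
    by (simp add: nn_integral_cmult nn_integral_multc)
  finally show ?thesis .
qed

text \<open>
  Identities between integrals with values in \<open>[0, \<infinity>]\<close> carry the finiteness and the value together;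
  this separates the two.
\<close>

lemma integral_transfer_scaled:
  fixes u :: "'a \<Rightarrow> real" and v :: "'b \<Rightarrow> real"
  assumes [measurable]: "u \<in> borel_measurable M" "v \<in> borel_measurable N"
    and nonneg: "\<And>x. 0 \<le> u x" "\<And>y. 0 \<le> v y" and k: "k > 0"
    and eq: "(\<integral>\<^sup>+x. ennreal (u x) \<partial>M) = ennreal k * (\<integral>\<^sup>+y. ennreal (v y) \<partial>N)"
  shows "integrable M u \<longleftrightarrow> integrable N v" and "integral\<^sup>L M u = k * integral\<^sup>L N v"
proof -
  show "integrable M u \<longleftrightarrow> integrable N v"
    using nonneg k by (auto simp: integrable_iff_bounded eq ennreal_mult_less_top)
  show "integral\<^sup>L M u = k * integral\<^sup>L N v"
    using nonneg k by (simp add: integral_eq_nn_integral eq enn2real_mult)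
qed

lemma gauss_integral_alpha:
  assumes "\<nu> > 0" and "\<phi> \<in> borel_measurable borel"
  defines "w \<equiv> \<lambda>Z. exp (- \<nu> * (norm Z)\<^sup>2) * (cmod (\<phi> (bc_alpha Z)))\<^sup>2"
  shows "integrable lborel w \<longleftrightarrow> integrable lborel (gauss_integrand (\<nu> / 2) \<phi>)"
    and "integral\<^sup>L lborel w = pi / (2 * \<nu>) * integral\<^sup>L lborel (gauss_integrand (\<nu> / 2) \<phi>)"
proof -
  note [measurable] = assms(2)
  have "(\<integral>\<^sup>+Z. ennreal (w Z) \<partial>lborel) =
      ennreal (1 / 4) * ((\<integral>\<^sup>+\<xi>. ennreal (gauss_integrand (\<nu> / 2) \<phi> \<xi>) \<partial>lborel) * ennreal (pi / (\<nu> / 2)))"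
    using nn_integral_gauss_product[of "\<lambda>\<xi>. ennreal ((cmod (\<phi> \<xi>))\<^sup>2)" "\<lambda>_. 1" \<nu>]
      nn_integral_gauss_complex[of "\<nu> / 2"] \<open>\<nu> > 0\<close>
    by (simp add: w_def gauss_integrand_def ennreal_mult)
  also have "\<dots> = ennreal (pi / (2 * \<nu>)) * (\<integral>\<^sup>+\<xi>. ennreal (gauss_integrand (\<nu> / 2) \<phi> \<xi>) \<partial>lborel)"
    using \<open>\<nu> > 0\<close> by (simp add: ennreal_mult'[symmetric] mult.assoc[symmetric] mult.commute)
  finally have eq: "(\<integral>\<^sup>+Z. ennreal (w Z) \<partial>lborel) =
    ennreal (pi / (2 * \<nu>)) * (\<integral>\<^sup>+\<xi>. ennreal (gauss_integrand (\<nu> / 2) \<phi> \<xi>) \<partial>lborel)" .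
  have meas: "w \<in> borel_measurable lborel" "gauss_integrand (\<nu> / 2) \<phi> \<in> borel_measurable lborel"
    unfolding w_def gauss_integrand_def[abs_def] by measurable
  show "integrable lborel w \<longleftrightarrow> integrable lborel (gauss_integrand (\<nu> / 2) \<phi>)"
    and "integral\<^sup>L lborel w = pi / (2 * \<nu>) * integral\<^sup>L lborel (gauss_integrand (\<nu> / 2) \<phi>)"
    using \<open>\<nu> > 0\<close> by (intro integral_transfer_scaled[OF meas _ _ _ eq];
      simp add: w_def gauss_integrand_def)+
qed

lemma gauss_integral_beta:
  assumes "\<nu> > 0" and "\<phi> \<in> borel_measurable borel"
  defines "w \<equiv> \<lambda>Z. exp (- \<nu> * (norm Z)\<^sup>2) * (cmod (\<phi> (bc_beta Z)))\<^sup>2"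
  shows "integrable lborel w \<longleftrightarrow> integrable lborel (gauss_integrand (\<nu> / 2) \<phi>)"
    and "integral\<^sup>L lborel w = pi / (2 * \<nu>) * integral\<^sup>L lborel (gauss_integrand (\<nu> / 2) \<phi>)"
proof -
  note [measurable] = assms(2)
  have "(\<integral>\<^sup>+Z. ennreal (w Z) \<partial>lborel) =
      ennreal (1 / 4) * (ennreal (pi / (\<nu> / 2)) * (\<integral>\<^sup>+\<xi>. ennreal (gauss_integrand (\<nu> / 2) \<phi> \<xi>) \<partial>lborel))"
    using nn_integral_gauss_product[of "\<lambda>_. 1" "\<lambda>\<xi>. ennreal ((cmod (\<phi> \<xi>))\<^sup>2)" \<nu>]
      nn_integral_gauss_complex[of "\<nu> / 2"] \<open>\<nu> > 0\<close>
    by (simp add: w_def gauss_integrand_def ennreal_mult)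
  also have "\<dots> = ennreal (pi / (2 * \<nu>)) * (\<integral>\<^sup>+\<xi>. ennreal (gauss_integrand (\<nu> / 2) \<phi> \<xi>) \<partial>lborel)"
    using \<open>\<nu> > 0\<close> by (simp add: ennreal_mult'[symmetric] mult.assoc[symmetric] mult.commute)
  finally have eq: "(\<integral>\<^sup>+Z. ennreal (w Z) \<partial>lborel) =
    ennreal (pi / (2 * \<nu>)) * (\<integral>\<^sup>+\<xi>. ennreal (gauss_integrand (\<nu> / 2) \<phi> \<xi>) \<partial>lborel)" .
  have meas: "w \<in> borel_measurable lborel" "gauss_integrand (\<nu> / 2) \<phi> \<in> borel_measurable lborel"
    unfolding w_def gauss_integrand_def[abs_def] by measurable
  show "integrable lborel w \<longleftrightarrow> integrable lborel (gauss_integrand (\<nu> / 2) \<phi>)"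
    and "integral\<^sup>L lborel w = pi / (2 * \<nu>) * integral\<^sup>L lborel (gauss_integrand (\<nu> / 2) \<phi>)"
    using \<open>\<nu> > 0\<close> by (intro integral_transfer_scaled[OF meas _ _ _ eq];
      simp add: w_def gauss_integrand_def)+
qed

section \<open>The bicomplex Bargmann space\<close>

text \<open>
  The components of an integrable function are its images under bounded linear maps; conversely,
  the function is the sum of such images of its components.
\<close>

lemma integrable_idem_iff:
  fixes p q :: "'a \<Rightarrow> real"
  shows "integrable M (\<lambda>x. idem (of_real (p x)) (of_real (q x))) \<longleftrightarrow> integrable M p \<and> integrable M q"
proof
  assume int: "integrable M (\<lambda>x. idem (of_real (p x)) (of_real (q x)))"
  show "integrable M p \<and> integrable M q"
    using integrable_bounded_linear[OF bounded_linear_bc_alpha int]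
      integrable_bounded_linear[OF bounded_linear_bc_beta int]
    by (simp add: complex_of_real_integrable_eq)
next
  assume "integrable M p \<and> integrable M q"
  then have int: "integrable M (\<lambda>x. complex_of_real (p x))" "integrable M (\<lambda>x. complex_of_real (q x))"
    by (simp_all add: complex_of_real_integrable_eq)
  have "bounded_linear (\<lambda>z. idem z 0)" "bounded_linear (\<lambda>z. idem 0 z)"
    by (simp_all add: linear_conv_bounded_linear[symmetric] linear_iff idem_eq field_simps)
  from Bochner_Integration.integrable_add[OF integrable_bounded_linear[OF this(1) int(1)]
      integrable_bounded_linear[OF this(2) int(2)]]
  show "integrable M (\<lambda>x. idem (of_real (p x)) (of_real (q x)))"
    by (simp add: idem_add)
qed

lemma entire_borel_measurable:
  assumes "\<phi> holomorphic_on UNIV"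
  shows "\<phi> \<in> borel_measurable borel"
  using assms by (intro borel_measurable_continuous_onI holomorphic_on_imp_continuous_on)

lemma split_measurable:
  assumes [measurable]: "\<phi> \<in> borel_measurable borel" "\<psi> \<in> borel_measurable borel"
    and f: "\<And>a b. f (idem a b) = idem (\<phi> a) (\<psi> b)"
  shows "f \<in> borel_measurable borel"
proof -
  have "f = (\<lambda>Z. idem (\<phi> (bc_alpha Z)) (\<psi> (bc_beta Z)))"
    by (metis f idem_alpha_beta)
  then show ?thesis by (simp add: idem_eq)
qed

lemma split_bc_integrand:
  assumes f: "\<And>a b. f (idem a b) = idem (\<phi> a) (\<psi> b)"
  shows "bc_integrand \<nu> f f =
    (\<lambda>Z. idem (of_real (exp (- \<nu> * (norm Z)\<^sup>2) * (cmod (\<phi> (bc_alpha Z)))\<^sup>2))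
         (of_real (exp (- \<nu> * (norm Z)\<^sup>2) * (cmod (\<psi> (bc_beta Z)))\<^sup>2)))"
proof -
  have "f Z = idem (\<phi> (bc_alpha Z)) (\<psi> (bc_beta Z))" for Z
    using f[of "bc_alpha Z" "bc_beta Z"] by simp
  then show ?thesis by (simp add: fun_eq_iff bc_integrand_self)
qed

lemma split_integrable_iff:
  assumes "\<nu> > 0" "\<phi> \<in> borel_measurable borel" "\<psi> \<in> borel_measurable borel"
    and f: "\<And>a b. f (idem a b) = idem (\<phi> a) (\<psi> b)"
  shows "integrable lborel (bc_integrand \<nu> f f) \<longleftrightarrow>
    integrable lborel (gauss_integrand (\<nu> / 2) \<phi>) \<and> integrable lborel (gauss_integrand (\<nu> / 2) \<psi>)"
  unfolding split_bc_integrand[of f \<phi> \<psi>, OF f] integrable_idem_iff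
  using assms by (simp only: gauss_integral_alpha(1) gauss_integral_beta(1))

text \<open>
  The constants match because \<open>(\<nu>/\<pi>)\<^sup>2 \<pi>/(2\<nu>) = (\<nu>/2)/\<pi>\<close>. Integrability is what allows the idempotent
  components to be taken under the integral.
\<close>

lemma split_bc_norm:
  assumes "\<nu> > 0" "\<phi> \<in> borel_measurable borel" "\<psi> \<in> borel_measurable borel"
    and f: "\<And>a b. f (idem a b) = idem (\<phi> a) (\<psi> b)"
    and "integrable lborel (gauss_integrand (\<nu> / 2) \<phi>)" "integrable lborel (gauss_integrand (\<nu> / 2) \<psi>)"
  shows "(bc_norm \<nu> f)\<^sup>2 = 1 / 2 * ((L2_norm (\<nu> / 2) \<phi>)\<^sup>2 + (L2_norm (\<nu> / 2) \<psi>)\<^sup>2)"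
proof -
  let ?I = "\<lambda>\<phi>. integral\<^sup>L lborel (gauss_integrand (\<nu> / 2) \<phi>)"
  have int: "integrable lborel (bc_integrand \<nu> f f)"
    using assms split_integrable_iff[of \<nu> \<phi> \<psi> f] by blast
  have "bc_alpha (\<integral>Z. bc_integrand \<nu> f f Z \<partial>lborel) = of_real (pi / (2 * \<nu>) * ?I \<phi>)"
    using integral_bounded_linear[OF bounded_linear_bc_alpha int]
      gauss_integral_alpha(2)[OF assms(1,2)]
    by (simp add: split_bc_integrand[of f \<phi> \<psi>, OF f] del: of_real_mult)
  moreover have "bc_beta (\<integral>Z. bc_integrand \<nu> f f Z \<partial>lborel) = of_real (pi / (2 * \<nu>) * ?I \<psi>)"
    using integral_bounded_linear[OF bounded_linear_bc_beta int]
      gauss_integral_beta(2)[OF assms(1,3)]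
    by (simp add: split_bc_integrand[of f \<phi> \<psi>, OF f] del: of_real_mult)
  ultimately have "bc_alpha (bc_inner \<nu> f f) = (\<nu> / pi)\<^sup>2 *\<^sub>R of_real (pi / (2 * \<nu>) * ?I \<phi>)"
    "bc_beta (bc_inner \<nu> f f) = (\<nu> / pi)\<^sup>2 *\<^sub>R of_real (pi / (2 * \<nu>) * ?I \<psi>)"
    by (simp_all only: bc_inner_def linear_scale[OF bounded_linear.linear[OF bounded_linear_bc_alpha]]
        linear_scale[OF bounded_linear.linear[OF bounded_linear_bc_beta]])
  moreover have "(\<nu> / pi)\<^sup>2 * (pi / (2 * \<nu>) * x) = \<nu> / 2 / pi * x" for x
    using \<open>\<nu> > 0\<close> by (simp add: power2_eq_square field_simps)
  ultimately have inner: "Re (bc_alpha (bc_inner \<nu> f f)) = \<nu> / 2 / pi * ?I \<phi>"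
    "Re (bc_beta (bc_inner \<nu> f f)) = \<nu> / 2 / pi * ?I \<psi>"
    by (simp_all only: scaleR_complex.sel Re_complex_of_real)
  have nonneg: "0 \<le> \<nu> / 2 / pi * ?I \<phi>" for \<phi>
    using \<open>\<nu> > 0\<close> by (intro mult_nonneg_nonneg integral_nonneg_AE) (auto simp: gauss_integrand_def)
  show ?thesis
    using nonneg[of \<phi>] nonneg[of \<psi>] unfolding bc_norm_def L2_norm_def inner
    by simp
qed

theorem theorem3p1:
  fixes \<nu> :: real
  assumes "\<nu> > 0"
  shows "bc_bargmann \<nu> =
      {f. \<exists>\<phi>p \<in> bargmann (\<nu> / 2). \<exists>\<phi>m \<in> bargmann (\<nu> / 2). \<forall>\<alpha> \<beta>.
        f (bc_of_complex \<alpha> *\<^sub>T e_plus + bc_of_complex \<beta> *\<^sub>T e_minus) =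
          bc_of_complex (\<phi>p \<alpha>) *\<^sub>T e_plus + bc_of_complex (\<phi>m \<beta>) *\<^sub>T e_minus} \<and>
    (\<forall>f. \<forall>\<phi>p \<in> bargmann (\<nu> / 2). \<forall>\<phi>m \<in> bargmann (\<nu> / 2).
      (\<forall>\<alpha> \<beta>. f (bc_of_complex \<alpha> *\<^sub>T e_plus + bc_of_complex \<beta> *\<^sub>T e_minus) =
          bc_of_complex (\<phi>p \<alpha>) *\<^sub>T e_plus + bc_of_complex (\<phi>m \<beta>) *\<^sub>T e_minus) \<longrightarrow>
      (bc_norm \<nu> f)\<^sup>2 = 1 / 2 * ((L2_norm (\<nu> / 2) \<phi>p)\<^sup>2 + (L2_norm (\<nu> / 2) \<phi>m)\<^sup>2))"
proof (intro conjI set_eqI iffI allI ballI impI)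
  note split = idem_def[symmetric]
  fix f
  assume "f \<in> bc_bargmann \<nu>"
  then have "bc_holomorphic f" and int: "integrable lborel (bc_integrand \<nu> f f)"
    by (auto simp: bc_bargmann_def H2_space_def)
  obtain \<phi> \<psi> where hol: "\<phi> holomorphic_on UNIV" "\<psi> holomorphic_on UNIV"
    and f: "\<And>a b. f (idem a b) = idem (\<phi> a) (\<psi> b)"
    using bc_holomorphic_imp_split[OF \<open>bc_holomorphic f\<close>] by metis
  have "\<phi> \<in> bargmann (\<nu> / 2)" "\<psi> \<in> bargmann (\<nu> / 2)"
    using split_integrable_iff[OF assms hol[THEN entire_borel_measurable] f] int hol
    by (simp_all add: bargmann_def)
  with f show "f \<in> {f. \<exists>\<phi>p \<in> bargmann (\<nu> / 2). \<exists>\<phi>m \<in> bargmann (\<nu> / 2). \<forall>\<alpha> \<beta>.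
        f (bc_of_complex \<alpha> *\<^sub>T e_plus + bc_of_complex \<beta> *\<^sub>T e_minus) =
          bc_of_complex (\<phi>p \<alpha>) *\<^sub>T e_plus + bc_of_complex (\<phi>m \<beta>) *\<^sub>T e_minus}"
    unfolding split by blast
next
  note split = idem_def[symmetric]
  fix f
  assume "f \<in> {f. \<exists>\<phi>p \<in> bargmann (\<nu> / 2). \<exists>\<phi>m \<in> bargmann (\<nu> / 2). \<forall>\<alpha> \<beta>.
        f (bc_of_complex \<alpha> *\<^sub>T e_plus + bc_of_complex \<beta> *\<^sub>T e_minus) =
          bc_of_complex (\<phi>p \<alpha>) *\<^sub>T e_plus + bc_of_complex (\<phi>m \<beta>) *\<^sub>T e_minus}"
  then obtain \<phi> \<psi> where hol: "\<phi> holomorphic_on UNIV" "\<psi> holomorphic_on UNIV"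
    and int: "integrable lborel (gauss_integrand (\<nu> / 2) \<phi>)"
      "integrable lborel (gauss_integrand (\<nu> / 2) \<psi>)"
    and f: "\<And>a b. f (idem a b) = idem (\<phi> a) (\<psi> b)"
    unfolding split bargmann_def by blast
  note meas = hol[THEN entire_borel_measurable]
  have "bc_holomorphic f" using hol f by (rule split_imp_bc_holomorphic)
  moreover have "f \<in> borel_measurable borel" using meas f by (rule split_measurable)
  moreover have "integrable lborel (bc_integrand \<nu> f f)"
    using split_integrable_iff[OF assms meas f] int by simp
  ultimately show "f \<in> bc_bargmann \<nu>" by (simp add: bc_bargmann_def H2_space_def)
next
  fix f \<phi> \<psi>
  assume mem: "\<phi> \<in> bargmann (\<nu> / 2)" "\<psi> \<in> bargmann (\<nu> / 2)"
    and "\<forall>\<alpha> \<beta>. f (bc_of_complex \<alpha> *\<^sub>T e_plus + bc_of_complex \<beta> *\<^sub>T e_minus) =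
          bc_of_complex (\<phi> \<alpha>) *\<^sub>T e_plus + bc_of_complex (\<psi> \<beta>) *\<^sub>T e_minus"
  then have f: "f (idem a b) = idem (\<phi> a) (\<psi> b)" for a b
    unfolding idem_def by simp
  from mem have "\<phi> \<in> borel_measurable borel" "\<psi> \<in> borel_measurable borel"
    and "integrable lborel (gauss_integrand (\<nu> / 2) \<phi>)" "integrable lborel (gauss_integrand (\<nu> / 2) \<psi>)"
    by (simp_all add: bargmann_def entire_borel_measurable)
  with assms f show "(bc_norm \<nu> f)\<^sup>2 = 1 / 2 * ((L2_norm (\<nu> / 2) \<phi>)\<^sup>2 + (L2_norm (\<nu> / 2) \<psi>)\<^sup>2)"
    by (intro split_bc_norm)
qed

end
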